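(* Let $M$ be either of the adjacency, Laplacian, distance or distance Laplacian matrices, and let $G$ and $H$ be two graphs with $n$ vertices. Then $G$ and $H$ are $M_x^{\mathbb{R}}$-codeterminantal if and only if $V\left(I^{\mathbb{Z}}_k(M_x(G))\right)=V\left(I^{\mathbb{Z}}_k(M_x(H))\right)$ for every $k\in\{1,\dots,n\}$.
   Context: Graphs are simple, finite and connected. For a graph $G$ with $n$ vertices: $A(G)$ is the adjacency matrix; $L(G)=\deg(G)-A(G)$ is the Laplacian, where $\deg(G)$ is the diagonal matrix of vertex degrees; $D(G)$ is the distance matrix (entry $(u,v)$ is the graph distance between $u$ and $v$); the distance Laplacian is $F(G)=T(G)-D(G)$, where $T(G)$ is the diagonal matrix of transmissions, the transmission of a vertex being the sum of its distances to all other vertices. For $M\in\{A,L,D,F\}$ put $M_x(G)=xI_n-M(G)$. For a commutative ring $\mathcal{R}\in\{\mathbb{Z},\mathbb{R}\}$, $I_k^{\mathcal{R}}(M_x(G))$ is the ideal of $\mathcal{R}[x]$ generated by all $k\times k$ minors of $M_x(G)$. $G$ and $H$ are $M_x^{\mathcal{R}}$-codeterminantal if $I_k^{\mathcal{R}}(M_x(G))=I_k^{\mathcal{R}}(M_x(H))$ for each $k\in\{1,\dots,n\}$. For an ideal $I$, $V(I)$ is its variety: the set of real numbers $a$ with $f(a)=0$ for all $f\in I$. *)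

theory Defs
  imports
    "Graph_Theory.Graph_Theory"
    "Jordan_Normal_Form.Char_Poly"
    "Jordan_Normal_Form.DL_Submatrix"
begin

text \<open>
  Simple graphs are the locale \<^locale>\<open>graph\<close>: finite, symmetric, loopless digraphs without
  parallel arcs. An edge \<open>{u, v}\<close> is represented by the two arcs between \<open>u\<close> and \<open>v\<close>, so
  \<^const>\<open>out_degree\<close> is the degree of a vertex.
\<close>

definition graph_dist :: "('a, 'b) pre_digraph \<Rightarrow> 'a \<Rightarrow> 'a \<Rightarrow> nat" where
  "graph_dist G u v = (LEAST k. \<exists>p. pre_digraph.awalk G u p v \<and> length p = k)"

definition transmission :: "('a, 'b) pre_digraph \<Rightarrow> 'a \<Rightarrow> nat" where
  "transmission G u = (\<Sum>v \<in> verts G - {u}. graph_dist G u v)"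

lemma (in wf_digraph) graph_dist_eq_\<mu>:
  assumes "u \<rightarrow>\<^sup>* v"
  shows "\<mu> (\<lambda>_. 1) u v = ereal (real (graph_dist G u v))"
proof -
  let ?P = "\<lambda>k. \<exists>p. awalk u p v \<and> length p = k"
  have cost: "awalk_cost (\<lambda>_. 1) p = real (length p)" for p :: "'b awalk"
    by (induction p) auto
  obtain p where "awalk u p v"
    using assms by (auto simp: reachable_awalk)
  then have "?P (length p)"
    by blast
  then have "?P (graph_dist G u v)"
    unfolding graph_dist_def by (rule LeastI)
  then obtain q where q: "awalk u q v" "length q = graph_dist G u v"
    by blast
  have le: "graph_dist G u v \<le> length p" if "awalk u p v" for p
    unfolding graph_dist_def using that by (auto intro: Least_le)
  show ?thesis
    unfolding \<mu>_def cost
  proof (rule INF_eqI)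
    fix y assume "\<And>p. p \<in> {p. awalk u p v} \<Longrightarrow> y \<le> ereal (real (length p))"
    from this[of q] show "y \<le> ereal (real (graph_dist G u v))"
      using q by simp
  qed (use le in auto)
qed

text \<open>
  The vertex set of a graph carries no order, so the rows and columns of its matrices are indexed
  by \<open>{0..<n}\<close> through an enumeration \<open>e\<close> of the vertices.
\<close>

definition vertex_enum :: "('a, 'b) pre_digraph \<Rightarrow> nat \<Rightarrow> (nat \<Rightarrow> 'a) \<Rightarrow> bool" where
  "vertex_enum G n e \<longleftrightarrow> bij_betw e {0..<n} (verts G)"

datatype matrix_kind = Adjacency | Laplacian | Distance | Distance_Laplacian

definition adjacency_mat :: "('a, 'b) pre_digraph \<Rightarrow> nat \<Rightarrow> (nat \<Rightarrow> 'a) \<Rightarrow> 'r :: comm_ring_1 mat" where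
  "adjacency_mat G n e = mat n n (\<lambda>(i, j). if (e i, e j) \<in> arcs_ends G then 1 else 0)"

definition distance_mat :: "('a, 'b) pre_digraph \<Rightarrow> nat \<Rightarrow> (nat \<Rightarrow> 'a) \<Rightarrow> 'r :: comm_ring_1 mat" where
  "distance_mat G n e = mat n n (\<lambda>(i, j). of_nat (graph_dist G (e i) (e j)))"

fun graph_mat ::
  "matrix_kind \<Rightarrow> ('a, 'b) pre_digraph \<Rightarrow> nat \<Rightarrow> (nat \<Rightarrow> 'a) \<Rightarrow> 'r :: comm_ring_1 mat" where
  "graph_mat Adjacency G n e = adjacency_mat G n e"
| "graph_mat Laplacian G n e =
     mat_diag n (\<lambda>i. of_nat (out_degree G (e i))) - adjacency_mat G n e"
| "graph_mat Distance G n e = distance_mat G n e"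
| "graph_mat Distance_Laplacian G n e =
     mat_diag n (\<lambda>i. of_nat (transmission G (e i))) - distance_mat G n e"

definition minors :: "nat \<Rightarrow> 'r :: comm_ring_1 mat \<Rightarrow> 'r set" where
  "minors k A = {det (submatrix A I J) | I J.
     I \<subseteq> {0..<dim_row A} \<and> J \<subseteq> {0..<dim_col A} \<and> card I = k \<and> card J = k}"

text \<open>
  Ideals of a commutative ring are its submodules, so the generated ideal is the \<open>span\<close> in the
  ring regarded as a module over itself.
\<close>

definition ideal_generated :: "'r :: comm_ring_1 set \<Rightarrow> 'r set" where
  "ideal_generated S = module.span (*) S"

text \<open>\<^term>\<open>char_poly_matrix A\<close> is the matrix \<open>x I - A\<close> with entries in the polynomial ring.\<close>

definition determinantal_ideal ::
  "nat \<Rightarrow> matrix_kind \<Rightarrow> ('a, 'b) pre_digraph \<Rightarrow> nat \<Rightarrow> (nat \<Rightarrow> 'a) \<Rightarrow> 'r :: comm_ring_1 poly set" where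
  "determinantal_ideal k M G n e = ideal_generated (minors k (char_poly_matrix (graph_mat M G n e)))"

definition codeterminantal ::
  "'r :: comm_ring_1 itself \<Rightarrow> matrix_kind \<Rightarrow> nat \<Rightarrow>
   ('a, 'b) pre_digraph \<Rightarrow> (nat \<Rightarrow> 'a) \<Rightarrow> ('c, 'd) pre_digraph \<Rightarrow> (nat \<Rightarrow> 'c) \<Rightarrow> bool" where
  "codeterminantal (_ :: 'r itself) M n G e H f \<longleftrightarrow>
     (\<forall>k \<in> {1..n}. (determinantal_ideal k M G n e :: 'r poly set) = determinantal_ideal k M H n f)"

definition real_variety :: "int poly set \<Rightarrow> real set" where
  "real_variety I = {a. \<forall>f \<in> I. poly (map_poly of_int f) a = 0}"

end

theory Submission
  imports
    Defs
    "Jordan_Normal_Form.Jordan_Normal_Form_Existence"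
    "Jordan_Normal_Form.Jordan_Normal_Form_Uniqueness"
begin

text \<open>
  All four matrices are symmetric with integer entries; symmetry is what makes the theorem true.
  Let \<open>A\<close> be such an \<open>n \<times> n\<close> matrix. By the spectral theorem (\<open>symmetric_similar_diagonal\<close>) it is similar over the
  reals to a diagonal matrix with entries \<open>d\<^sub>0, \<dots>, d\<^sub>n\<^sub>-\<^sub>1\<close>. A similarity of real matrices turns into
  multiplication of \<open>x I - A\<close> by invertible constant matrices, and such multiplications preserve
  the ideal generated by the \<open>k \<times> k\<close> minors (\<open>ideal_minors_char_poly_matrix_similar\<close>), because
  each minor of a product is a linear combination of minors of either factor.
  So the determinantal ideals of \<open>A\<close> are those of its diagonal form.

  For the diagonal form the real zeros of these ideals can be read off: evaluated at \<open>a\<close>, all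
  \<open>k \<times> k\<close> minors vanish iff fewer than \<open>k\<close> of the numbers \<open>a - d\<^sub>i\<close> are nonzero
  (\<open>poly_zero_set_ideal_minors\<close>). Hence the varieties for \<open>k = 1, \<dots>, n\<close> determine how often every
  real \<open>a\<close> occurs among the \<open>d\<^sub>i\<close>. If two symmetric matrices have the same varieties, their diagonal
  forms therefore agree up to a permutation, and so do all their determinantal ideals over the
  reals (\<open>diagonalizable_ideal_minors_eqI\<close>).

  It remains to relate the two coefficient rings. The integer and the real ideal are generated by
  the same minors, so they have the same real zeros (\<open>real_variety_determinantal_ideal\<close>). So
  equality of the real ideals implies equality of the varieties, and conversely a hypothesis on the
  varieties is one about the zero sets of the real ideals.
\<close>

section \<open>Generated ideals\<close>

lemma module_mult: "Modules.module ((*) :: 'r :: comm_ring_1 \<Rightarrow> 'r \<Rightarrow> 'r)"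
  by unfold_locales (simp_all add: algebra_simps)

lemma ideal_generated_superset: "S \<subseteq> ideal_generated S"
  unfolding ideal_generated_def by (rule Modules.module.span_superset[OF module_mult])

lemma ideal_generated_mult: "x \<in> ideal_generated S \<Longrightarrow> c * x \<in> ideal_generated S"
  unfolding ideal_generated_def by (rule Modules.module.span_scale[OF module_mult])

lemma ideal_generated_zero: "0 \<in> ideal_generated S"
  unfolding ideal_generated_def by (rule Modules.module.span_zero[OF module_mult])

lemma ideal_generated_sum:
  "(\<And>i. i \<in> F \<Longrightarrow> g i \<in> ideal_generated S) \<Longrightarrow> sum g F \<in> ideal_generated S"
  unfolding ideal_generated_def by (rule Modules.module.span_sum[OF module_mult])

lemma ideal_generated_least:
  assumes "S \<subseteq> ideal_generated T"
  shows "ideal_generated S \<subseteq> ideal_generated T"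
  using Modules.module.span_minimal[OF module_mult, of S] Modules.module.subspace_span[OF module_mult] assms
  unfolding ideal_generated_def by blast

text \<open>
  The kernel of a ring homomorphism is an ideal. Used with evaluations of polynomials, this
  reduces the variety of an ideal to the common zeros of its generators.
\<close>

lemma ideal_generated_vanish_iff:
  assumes "comm_ring_hom h"
  shows "(\<forall>x \<in> ideal_generated S. h x = 0) \<longleftrightarrow> (\<forall>x \<in> S. h x = 0)"
proof
  interpret comm_ring_hom h by fact
  assume S: "\<forall>x \<in> S. h x = 0"
  have "Modules.module.subspace (*) {x. h x = 0}"
    by (rule Modules.module.subspaceI[OF module_mult]) (auto simp: hom_distribs)
  with S have "ideal_generated S \<subseteq> {x. h x = 0}"
    unfolding ideal_generated_def by (intro Modules.module.span_minimal[OF module_mult]) auto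
  then show "\<forall>x \<in> ideal_generated S. h x = 0"
    by blast
qed (use ideal_generated_superset in blast)

section \<open>Minors with arbitrary row and column selections\<close>

text \<open>
  Rows and columns are selected by functions rather than by sets, so that repetitions and any order
  are allowed. Both occur when the determinant of a product is expanded.
\<close>

definition indexed_minor :: "'r :: comm_ring_1 mat \<Rightarrow> nat \<Rightarrow> (nat \<Rightarrow> nat) \<Rightarrow> (nat \<Rightarrow> nat) \<Rightarrow> 'r" where
  "indexed_minor A k r c = det (mat k k (\<lambda>(i, j). A $$ (r i, c j)))"

lemma bij_betw_pick:
  assumes "finite I"
  shows "bij_betw (pick I) {0..<card I} I"
proof (rule bij_betw_imageI)
  show inj: "inj_on (pick I) {0..<card I}"
  proof (rule inj_onI)
    fix i j assume "i \<in> {0..<card I}" "j \<in> {0..<card I}" "pick I i = pick I j"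
    then show "i = j"
      using pick_mono_le[of j I i] pick_mono_le[of i I j] by (cases i j rule: linorder_cases) auto
  qed
  have "pick I ` {0..<card I} \<subseteq> I"
    using pick_in_set_le by auto
  then show "pick I ` {0..<card I} = I"
    using assms inj by (intro card_subset_eq) (simp_all add: card_image)
qed

lemma det_submatrix:
  assumes "I \<subseteq> {0..<dim_row A}" "J \<subseteq> {0..<dim_col A}" "card I = k" "card J = k"
  shows "det (submatrix A I J) = indexed_minor A k (pick I) (pick J)"
proof -
  have "{i. i < dim_row A \<and> i \<in> I} = I" "{j. j < dim_col A \<and> j \<in> J} = J"
    using assms by auto
  then show ?thesis
    using assms unfolding submatrix_def indexed_minor_def by simp
qed

lemma minors_eq_indexed_minors:
  "minors k A = {indexed_minor A k (pick I) (pick J) | I J.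
     I \<subseteq> {0..<dim_row A} \<and> J \<subseteq> {0..<dim_col A} \<and> card I = k \<and> card J = k}"
  unfolding minors_def using det_submatrix by (smt (verit, best) Collect_cong)

lemma minor_indexedE:
  assumes "m \<in> minors k A"
  obtains r c where "m = indexed_minor A k r c"
    "r \<in> {0..<k} \<rightarrow> {0..<dim_row A}" "c \<in> {0..<k} \<rightarrow> {0..<dim_col A}"
proof -
  from assms obtain I J where "m = indexed_minor A k (pick I) (pick J)"
    "I \<subseteq> {0..<dim_row A}" "J \<subseteq> {0..<dim_col A}" "card I = k" "card J = k"
    unfolding minors_eq_indexed_minors by blast
  moreover from this have "pick I \<in> {0..<k} \<rightarrow> {0..<dim_row A}" "pick J \<in> {0..<k} \<rightarrow> {0..<dim_col A}"
    using pick_in_set_le[of _ I] pick_in_set_le[of _ J] by fastforce+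
  ultimately show thesis
    using that by blast
qed

lemma indexed_minor_transpose:
  assumes "r \<in> {0..<k} \<rightarrow> {0..<dim_row A}" "c \<in> {0..<k} \<rightarrow> {0..<dim_col A}"
  shows "indexed_minor A\<^sup>T k c r = indexed_minor A k r c"
proof -
  have "mat k k (\<lambda>(i, j). A\<^sup>T $$ (c i, r j)) = (mat k k (\<lambda>(i, j). A $$ (r i, c j)))\<^sup>T"
    using assms by (intro eq_matI) (auto simp: Pi_iff)
  then show ?thesis
    unfolding indexed_minor_def by (simp add: det_transpose[of _ k])
qed

text \<open>
  A selection with a repeated row has determinant zero, and any other selection is a reordering of
  an increasing one, which only changes the sign. The alternative is the same for all column
  selections \<open>c\<close>, so it can be applied to the rows first and then, after transposition, to the
  columns.
\<close>

lemma indexed_minor_rows_cases: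
  assumes r: "r \<in> {0..<k} \<rightarrow> {0..<m}"
  obtains "\<And>c. indexed_minor A k r c = 0"
  | s I where "I \<subseteq> {0..<m}" "card I = k"
      "\<And>c. indexed_minor A k r c = s * indexed_minor A k (pick I) c"
proof (cases "inj_on r {0..<k}")
  case True
  define I where "I = r ` {0..<k}"
  have I: "I \<subseteq> {0..<m}" "card I = k" "finite I"
    using r True by (auto simp: I_def card_image)
  define p where "p = (\<lambda>i. if i \<in> {0..<k} then (the_inv_into {0..<k} (pick I) \<circ> r) i else i)"
  have pick: "bij_betw (pick I) {0..<k} I"
    using bij_betw_pick I by blast
  have "bij_betw (the_inv_into {0..<k} (pick I) \<circ> r) {0..<k} {0..<k}"
    using True by (intro bij_betw_trans[OF _ bij_betw_the_inv_into[OF pick]])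
      (simp add: I_def bij_betw_imageI)
  then have "bij_betw p {0..<k} {0..<k}"
    by (rule bij_betw_cong[THEN iffD1, rotated]) (simp add: p_def)
  then have p: "p permutes {0..<k}"
    by (rule bij_imp_permutes) (auto simp: p_def)
  \<comment> \<open>By its definition, \<open>p\<close> sends \<open>i\<close> to the rank of \<open>r i\<close> within \<open>I\<close>.\<close>
  have pick_p: "pick I (p i) = r i" if "i < k" for i
    using that pick f_the_inv_into_f_bij_betw[OF pick, of "r i"] by (simp add: p_def I_def)
  have "indexed_minor A k r c = signof p * indexed_minor A k (pick I) c" for c
  proof -
    have "mat k k (\<lambda>(i, j). A $$ (r i, c j)) =
        mat k k (\<lambda>(i, j). mat k k (\<lambda>(i, j). A $$ (pick I i, c j)) $$ (p i, j))"
      using permutes_in_image[OF p] by (intro eq_matI) (auto simp: pick_p)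
    then show ?thesis
      unfolding indexed_minor_def by (simp add: det_permute_rows[OF _ p])
  qed
  with I show thesis
    using that(2) by blast
next
  case False
  then obtain i j where ij: "i < k" "j < k" "i \<noteq> j" "r i = r j"
    by (auto simp: inj_on_def)
  have "indexed_minor A k r c = 0" for c
    unfolding indexed_minor_def
    by (rule det_identical_rows[OF _ ij(3) ij(1,2)]) (use ij in \<open>auto intro!: eq_vecI\<close>)
  then show thesis
    using that(1) by blast
qed

lemma indexed_minor_in_ideal:
  assumes r: "r \<in> {0..<k} \<rightarrow> {0..<dim_row A}" and c: "c \<in> {0..<k} \<rightarrow> {0..<dim_col A}"
  shows "indexed_minor A k r c \<in> ideal_generated (minors k A)"
  using r
proof (cases rule: indexed_minor_rows_cases[where A = A])
  case 1
  then show ?thesis by (simp add: ideal_generated_zero)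
next
  case rows: (2 s I)
  have I: "pick I \<in> {0..<k} \<rightarrow> {0..<dim_row A}"
    using rows(1,2) pick_in_set_le[of _ I] by fastforce
  from c show ?thesis
  proof (cases rule: indexed_minor_rows_cases[where A = "A\<^sup>T"])
    case 1
    then show ?thesis
      using rows(3) indexed_minor_transpose[OF I c] by (simp add: ideal_generated_zero)
  next
    case cols: (2 t J)
    have J: "pick J \<in> {0..<k} \<rightarrow> {0..<dim_col A}"
      using cols(1,2) pick_in_set_le[of _ J] by fastforce
    have "indexed_minor A k r c = (s * t) * indexed_minor A k (pick I) (pick J)"
      using rows(3)[of c] cols(3)[of "pick I"] indexed_minor_transpose[OF I c]
        indexed_minor_transpose[OF I J] by (simp add: mult.assoc)
    moreover have "indexed_minor A k (pick I) (pick J) \<in> minors k A"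
      unfolding minors_eq_indexed_minors using rows cols by auto
    ultimately show ?thesis
      using ideal_generated_superset ideal_generated_mult by (metis subsetD)
  qed
qed

lemma (in comm_ring_hom) minors_hom: "minors k (map_mat hom A) = hom ` minors k A"
proof -
  have "indexed_minor (map_mat hom A) k (pick I) (pick J) = hom (indexed_minor A k (pick I) (pick J))"
    if IJ: "I \<subseteq> {0..<dim_row A}" "J \<subseteq> {0..<dim_col A}" "card I = k" "card J = k" for I J
  proof -
    have "pick I \<in> {0..<k} \<rightarrow> {0..<dim_row A}" "pick J \<in> {0..<k} \<rightarrow> {0..<dim_col A}"
      using IJ pick_in_set_le[of _ I] pick_in_set_le[of _ J] by fastforce+
    then have "mat k k (\<lambda>(i, j). map_mat hom A $$ (pick I i, pick J j)) =
        map_mat hom (mat k k (\<lambda>(i, j). A $$ (pick I i, pick J j)))"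
      by (intro eq_matI) (auto simp: Pi_iff)
    then show ?thesis
      unfolding indexed_minor_def by simp
  qed
  then show ?thesis
    unfolding minors_eq_indexed_minors by (auto simp: image_def) metis+
qed

lemma ideal_minors_vanish_iff:
  assumes h: "comm_ring_hom h"
  shows "(\<forall>x \<in> ideal_generated (minors k A). h x = 0) \<longleftrightarrow>
    (\<forall>m \<in> minors k (map_mat h A). m = 0)"
  unfolding ideal_generated_vanish_iff[OF h] comm_ring_hom.minors_hom[OF h] by simp

section \<open>Minors of products and similarity\<close>

text \<open>
  Multilinearity: every row of the matrix is a linear combination of the \<open>n\<close> rows \<open>q l\<close>, and \<open>f\<close>
  chooses one term from each. Setting \<open>f\<close> to the identity outside \<open>{0..<k}\<close> makes the choices a
  finite set of functions.
\<close>

lemma det_rows_linear_combinations: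
  fixes p :: "nat \<Rightarrow> nat \<Rightarrow> 'r :: comm_ring_1"
  shows "det (mat k k (\<lambda>(i, j). \<Sum>l = 0..<n. p i l * q l j)) =
    (\<Sum>f \<in> {f. (\<forall>i \<in> {0..<k}. f i \<in> {0..<n}) \<and> (\<forall>i. i \<notin> {0..<k} \<longrightarrow> f i = i)}.
      (\<Prod>i = 0..<k. p i (f i)) * det (mat k k (\<lambda>(i, j). q (f i) j)))"
proof -
  define a where "a = (\<lambda>i l. p i l \<cdot>\<^sub>v vec k (q l))"
  have a: "a \<in> {0..<k} \<rightarrow> {0..<n} \<rightarrow> carrier_vec k"
    by (simp add: a_def)
  have "mat k k (\<lambda>(i, j). \<Sum>l = 0..<n. p i l * q l j) =
      mat\<^sub>r k k (\<lambda>i. finsum_vec TYPE('r) k (a i) {0..<n})"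
    by (rule eq_matI) (simp_all add: a_def index_finsum_vec)
  moreover have "det (mat\<^sub>r k k (\<lambda>i. a i (f i))) =
      (\<Prod>i = 0..<k. p i (f i)) * det (mat k k (\<lambda>(i, j). q (f i) j))" for f
  proof -
    have "mat\<^sub>r k k (\<lambda>i. vec k (q (f i))) = mat k k (\<lambda>(i, j). q (f i) j)"
      by (rule eq_matI) simp_all
    then show ?thesis
      unfolding a_def by (subst det_rows_mul) auto
  qed
  ultimately show ?thesis
    using det_linear_rows_sum[OF _ a] by simp
qed

text \<open>
  The rows of \<open>P * Q\<close> are linear combinations of those of \<open>Q\<close>. This weak form of the
  Cauchy-Binet formula suffices, as only membership in the ideal matters.
\<close>

lemma minors_mult_right_factor:
  assumes P: "P \<in> carrier_mat m n" and Q: "Q \<in> carrier_mat n l"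
  shows "minors k (P * Q) \<subseteq> ideal_generated (minors k Q)"
proof
  fix d assume "d \<in> minors k (P * Q)"
  then obtain r c where d: "d = indexed_minor (P * Q) k r c"
    and r: "r \<in> {0..<k} \<rightarrow> {0..<m}" and c: "c \<in> {0..<k} \<rightarrow> {0..<l}"
    using minor_indexedE[of d k "P * Q"] P Q by auto
  have "mat k k (\<lambda>(i, j). (P * Q) $$ (r i, c j)) =
      mat k k (\<lambda>(i, j). \<Sum>h = 0..<n. P $$ (r i, h) * Q $$ (h, c j))"
    using P Q r c by (intro eq_matI) (auto simp: scalar_prod_def Pi_iff)
  then have "d = (\<Sum>f \<in> {f. (\<forall>i \<in> {0..<k}. f i \<in> {0..<n}) \<and> (\<forall>i. i \<notin> {0..<k} \<longrightarrow> f i = i)}.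
      (\<Prod>i = 0..<k. P $$ (r i, f i)) * indexed_minor Q k f c)"
    unfolding d indexed_minor_def
    using det_rows_linear_combinations[of k "\<lambda>i h. P $$ (r i, h)" "\<lambda>h j. Q $$ (h, c j)" n] by simp
  also have "\<dots> \<in> ideal_generated (minors k Q)"
    using Q c by (intro ideal_generated_sum ideal_generated_mult indexed_minor_in_ideal) auto
  finally show "d \<in> ideal_generated (minors k Q)" .
qed

lemma minors_transpose_subset: "minors k A\<^sup>T \<subseteq> minors k A"
proof
  fix d assume "d \<in> minors k A\<^sup>T"
  then obtain I J where IJ: "d = indexed_minor A\<^sup>T k (pick J) (pick I)"
    "I \<subseteq> {0..<dim_row A}" "J \<subseteq> {0..<dim_col A}" "card I = k" "card J = k"
    unfolding minors_eq_indexed_minors by auto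
  moreover have "pick I \<in> {0..<k} \<rightarrow> {0..<dim_row A}" "pick J \<in> {0..<k} \<rightarrow> {0..<dim_col A}"
    using IJ pick_in_set_le[of _ I] pick_in_set_le[of _ J] by fastforce+
  ultimately show "d \<in> minors k A"
    unfolding minors_eq_indexed_minors by (auto simp: indexed_minor_transpose)
qed

lemma minors_transpose: "minors k A\<^sup>T = minors k A"
  using minors_transpose_subset[of k A] minors_transpose_subset[of k "A\<^sup>T"] by simp

lemma minors_mult_left_factor:
  assumes P: "P \<in> carrier_mat m n" and Q: "Q \<in> carrier_mat n l"
  shows "minors k (P * Q) \<subseteq> ideal_generated (minors k P)"
  using minors_mult_right_factor[of "Q\<^sup>T" l n "P\<^sup>T" m k] P Q
  by (simp add: minors_transpose flip: transpose_mult[OF P Q])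

lemma ideal_generated_minors_mult_le:
  assumes "P \<in> carrier_mat m m" and "A \<in> carrier_mat m n" and "Q \<in> carrier_mat n n"
  shows "ideal_generated (minors k (P * A * Q)) \<subseteq> ideal_generated (minors k A)"
proof -
  have "ideal_generated (minors k (P * A * Q)) \<subseteq> ideal_generated (minors k (P * A))"
    using assms by (intro ideal_generated_least minors_mult_left_factor[of _ m n _ n]) auto
  also have "\<dots> \<subseteq> ideal_generated (minors k A)"
    using assms by (intro ideal_generated_least minors_mult_right_factor[of _ m m _ n]) auto
  finally show ?thesis .
qed

lemma char_poly_matrix_minus:
  assumes "A \<in> carrier_mat n n"
  shows "char_poly_matrix A = [:0, 1:] \<cdot>\<^sub>m 1\<^sub>m n - map_mat (\<lambda>a. [:a:]) A"
  using assms unfolding char_poly_matrix_def by (intro eq_matI) auto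

text \<open>
  The matrix \<open>x I\<close> is central, so conjugation by the constant matrices \<open>P\<close> and \<open>Q = P\<^sup>-\<^sup>1\<close> fixes it.
\<close>

lemma char_poly_matrix_similar:
  fixes A :: "'a :: comm_ring_1 mat"
  assumes sim: "similar_mat_wit A B P Q" and A: "A \<in> carrier_mat n n"
  shows "char_poly_matrix A =
    map_mat (\<lambda>a. [:a:]) P * char_poly_matrix B * map_mat (\<lambda>a. [:a:]) Q"
proof -
  interpret const: comm_ring_hom "\<lambda>a :: 'a. [:a:]"
    by unfold_locales (auto simp: one_pCons)
  note wit = similar_mat_witD2[OF A sim]
  define P' B' Q' where
    "P' = map_mat (\<lambda>a. [:a:]) P" and "B' = map_mat (\<lambda>a. [:a:]) B" and "Q' = map_mat (\<lambda>a. [:a:]) Q"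
  have [simp]: "P' \<in> carrier_mat n n" "B' \<in> carrier_mat n n" "Q' \<in> carrier_mat n n"
    using wit by (auto simp: P'_def B'_def Q'_def)
  let ?X = "[:0, 1:] \<cdot>\<^sub>m 1\<^sub>m n :: 'a poly mat"
  have PQ: "P' * Q' = 1\<^sub>m n"
    unfolding P'_def Q'_def using wit
    by (simp add: const.mat_hom_one flip: const.mat_hom_mult[of P n n Q n])
  have "P' * (?X - B') * Q' = P' * ?X * Q' - P' * B' * Q'"
    by (subst mult_minus_distrib_mat[of _ n n _ n], simp, simp, simp,
        subst minus_mult_distrib_mat[of _ n n _ _ n]) (auto intro!: mult_carrier_mat[of _ n n])
  also have "P' * ?X * Q' = ?X"
    by (simp add: mult_smult_distrib[of _ n n _ n] mult_smult_assoc_mat[of _ n n _ n] PQ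
      right_mult_one_mat[of _ n n])
  also have "P' * B' * Q' = map_mat (\<lambda>a. [:a:]) A"
    unfolding wit(3) P'_def B'_def Q'_def using wit
    by (simp add: const.mat_hom_mult[of _ n n _ n])
  finally show ?thesis
    using char_poly_matrix_minus[OF A] char_poly_matrix_minus[of B n] wit
    by (simp add: P'_def B'_def Q'_def)
qed

lemma ideal_minors_char_poly_matrix_similar:
  assumes "similar_mat A B"
  shows "ideal_generated (minors k (char_poly_matrix A)) =
    ideal_generated (minors k (char_poly_matrix B))"
proof -
  have le: "ideal_generated (minors k (char_poly_matrix A)) \<subseteq>
      ideal_generated (minors k (char_poly_matrix B))" if "similar_mat A B" for A B :: "'a mat"
  proof -
    from that obtain P Q where wit: "similar_mat_wit A B P Q"
      unfolding similar_mat_def by blast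
    define n where "n = dim_row A"
    note * = similar_mat_witD[OF n_def wit]
    show ?thesis
      unfolding char_poly_matrix_similar[OF wit *(4)]
      using * by (intro ideal_generated_minors_mult_le[of _ n _ n]) auto
  qed
  show ?thesis
    using le[OF assms] le[OF similar_mat_sym[OF assms]] by blast
qed

section \<open>Diagonalization of real symmetric matrices\<close>

text \<open>
  If \<open>M\<^sup>2 v = 0\<close> then the squared length of \<open>M v\<close> is \<open>M v \<bullet> M v = M\<^sup>2 v \<bullet> v = 0\<close>. Applied to
  \<open>M = A - a I\<close>, this rules out Jordan blocks of size greater than one.
\<close>

lemma mat_kernel_symmetric_square:
  fixes M :: "real mat"
  assumes M: "M \<in> carrier_mat n n" and sym: "M\<^sup>T = M"
  shows "mat_kernel (M * M) = mat_kernel M"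
proof
  show "mat_kernel (M * M) \<subseteq> mat_kernel M"
  proof
    fix v assume "v \<in> mat_kernel (M * M)"
    then have v: "v \<in> carrier_vec n" "(M * M) *\<^sub>v v = 0\<^sub>v n"
      using mat_kernelD[of "M * M" n n] M by auto
    have Mv: "M *\<^sub>v v \<in> carrier_vec n"
      using M v by simp
    have "(M *\<^sub>v v) \<bullet> (M *\<^sub>v v) = (M *\<^sub>v (M *\<^sub>v v)) \<bullet> v"
      using transpose_vec_mult_scalar[OF M v(1) Mv] sym by simp
    also have "M *\<^sub>v (M *\<^sub>v v) = 0\<^sub>v n"
      using v M assoc_mult_mat_vec[OF M M v(1)] by simp
    finally have "M *\<^sub>v v = 0\<^sub>v n"
      using conjugate_square_eq_0_vec[OF Mv] v by simp
    then show "v \<in> mat_kernel M"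
      using mat_kernelI[OF M v(1)] by blast
  qed
next
  show "mat_kernel M \<subseteq> mat_kernel (M * M)"
  proof
    fix v assume "v \<in> mat_kernel M"
    then have v: "v \<in> carrier_vec n" "M *\<^sub>v v = 0\<^sub>v n"
      using mat_kernelD[OF M] by auto
    then have "(M * M) *\<^sub>v v = 0\<^sub>v n"
      using M assoc_mult_mat_vec[OF M M v(1)] by (auto intro!: eq_vecI)
    then show "v \<in> mat_kernel (M * M)"
      using M v by (intro mat_kernelI[of _ n n]) auto
  qed
qed

text \<open>
  Compare \<open>A v \<bullet> cnj v = k (v \<bullet> cnj v)\<close> with \<open>v \<bullet> A (cnj v) = cnj k (v \<bullet> cnj v)\<close>.
\<close>

lemma eigenvalue_symmetric_real:
  fixes A :: "real mat"
  assumes A: "A \<in> carrier_mat n n" and sym: "A\<^sup>T = A"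
    and ev: "eigenvalue (map_mat complex_of_real A) k"
  shows "k \<in> \<real>"
proof -
  let ?C = "map_mat complex_of_real A"
  have C: "?C \<in> carrier_mat n n"
    using A by simp
  from ev obtain v where v: "v \<in> carrier_vec n" "v \<noteq> 0\<^sub>v n" "?C *\<^sub>v v = k \<cdot>\<^sub>v v"
    using A unfolding eigenvalue_def eigenvector_def by auto
  have Cc: "?C *\<^sub>v conjugate v = conjugate (?C *\<^sub>v v)"
    using A v(1) by (intro eq_vecI) (auto simp: scalar_prod_def)
  have "k * (v \<bullet> conjugate v) = (?C *\<^sub>v v) \<bullet> conjugate v"
    using v by simp
  also have "\<dots> = v \<bullet> (?C *\<^sub>v conjugate v)"
    using transpose_vec_mult_scalar[OF C _ v(1), of "conjugate v"] v map_mat_transpose[of complex_of_real A] sym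
    by simp
  also have "\<dots> = cnj k * (v \<bullet> conjugate v)"
    unfolding Cc v(3) using v(1) by (simp add: conjugate_smult_vec)
  finally have "k = cnj k"
    using conjugate_square_eq_0_vec[OF v(1)] v(2) by simp
  then show "k \<in> \<real>"
    by (simp add: Reals_cnj_iff)
qed

text \<open>
  The characteristic polynomial splits over the complex numbers with real roots only, and the
  factorization descends because the embedding of real polynomials is injective.
\<close>

lemma char_poly_symmetric_splits:
  fixes A :: "real mat"
  assumes A: "A \<in> carrier_mat n n" and sym: "A\<^sup>T = A"
  shows "\<exists>rs. char_poly A = (\<Prod>r \<leftarrow> rs. [:- r, 1:])"
proof -
  let ?C = "map_mat complex_of_real A"
  interpret map_poly_inj_idom_hom complex_of_real ..
  have C: "?C \<in> carrier_mat n n"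
    using A by simp
  obtain es where es: "char_poly ?C = (\<Prod>e \<leftarrow> es. [:- e, 1:])"
    using char_poly_factorized[OF C] by blast
  have "e \<in> \<real>" if "e \<in> set es" for e
  proof (rule eigenvalue_symmetric_real[OF A sym])
    show "eigenvalue ?C e"
      unfolding eigenvalue_root_char_poly[OF C] es poly_prod_list using that
      by (auto simp: prod_list_zero_iff intro!: image_eqI[of _ _ e])
  qed
  then have "map complex_of_real (map Re es) = es"
    by (auto intro!: map_idI)
  define rs where "rs = map Re es"
  have es': "map complex_of_real rs = es"
    unfolding rs_def by fact
  have "map_poly complex_of_real (\<Prod>r \<leftarrow> rs. [:- r, 1:]) = (\<Prod>r \<leftarrow> rs. [:- complex_of_real r, 1:])"
    by (induction rs) (simp_all only: list.map prod_list.Nil prod_list.Cons hom_one hom_mult,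
        simp add: hom_distribs)
  also have "\<dots> = map_poly complex_of_real (char_poly A)"
    using es of_real_hom.char_poly_hom[OF A, where 'a = complex]
    by (simp add: o_def flip: es')
  finally have "char_poly A = (\<Prod>r \<leftarrow> rs. [:- r, 1:])"
    using injectivity by metis
  then show ?thesis
    by blast
qed

lemma jordan_matrix_unit_blocks:
  "jordan_matrix (map (Pair 1) ds) = mat_diag (length ds) ((!) ds)"
proof (induction ds)
  case Nil
  then show ?case
    by (auto simp: jordan_matrix_def mat_diag_def)
next
  case (Cons d ds)
  have len: "sum_list (map fst (map (Pair 1) ds)) = length ds"
    by (induction ds) auto
  show ?case
    unfolding list.map jordan_matrix_Cons Cons.IH len
    by (rule eq_matI) (auto simp: mat_diag_def nth_Cons')
qed

text \<open>
  The sum of \<open>min k b\<close> over the sizes \<open>b\<close> of the Jordan blocks for an eigenvalue \<open>a\<close> is the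
  dimension of the kernel of \<open>(A - a I)\<^sup>k\<close>, so equal kernels for \<open>k = 1\<close> and \<open>k = 2\<close> bound the sizes.
\<close>

lemma min_2_sum_eq_min_1_sum:
  fixes xs :: "nat list"
  assumes "(\<Sum>x \<leftarrow> xs. min 2 x) = (\<Sum>x \<leftarrow> xs. min 1 x)" and "x \<in> set xs"
  shows "x \<le> 1"
  using assms
proof (induction xs)
  case (Cons y ys)
  have "(\<Sum>x \<leftarrow> ys. min 1 x) \<le> (\<Sum>x \<leftarrow> ys. min 2 x)"
    by (rule sum_list_mono) simp
  with Cons.prems(1) have "min 2 y = min 1 y" "(\<Sum>x \<leftarrow> ys. min 2 x) = (\<Sum>x \<leftarrow> ys. min 1 x)"
    by auto
  with Cons show ?case
    by auto
qed simp

text \<open>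
  The Jordan normal form exists over the reals since the characteristic polynomial splits. As
  \<open>A - a I\<close> and its square have the same kernel, all Jordan blocks have size one.
\<close>

lemma symmetric_similar_diagonal:
  fixes A :: "real mat"
  assumes A: "A \<in> carrier_mat n n" and sym: "A\<^sup>T = A"
  obtains d where "similar_mat A (mat_diag n d)"
proof -
  obtain bs where jnf: "jordan_nf A bs"
    using jordan_nf_exists[OF A] char_poly_symmetric_splits[OF A sym] by blast
  have size: "b = 1" if "(b, x) \<in> set bs" for b x
  proof -
    let ?M = "char_matrix A x"
    let ?sizes = "map fst (filter (\<lambda>(b, y). y = x) bs)"
    have M: "?M \<in> carrier_mat n n" "?M\<^sup>T = ?M"
      using A sym by (auto simp: char_matrix_def transpose_add)
    have "dim_gen_eigenspace A x 2 = dim_gen_eigenspace A x 1"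
      using M mat_kernel_symmetric_square[OF M]
      by (simp add: dim_gen_eigenspace_def kernel_dim_def numeral_2_eq_2)
    then have "(\<Sum>b \<leftarrow> ?sizes. min 2 b) = (\<Sum>b \<leftarrow> ?sizes. min 1 b)"
      unfolding dim_gen_eigenspace[OF jnf] .
    moreover have "b \<in> set ?sizes"
      using that by force
    ultimately have "b \<le> 1"
      by (rule min_2_sum_eq_min_1_sum)
    moreover have "b \<noteq> 0"
      using jnf that unfolding jordan_nf_def by force
    ultimately show ?thesis by simp
  qed
  have "map (Pair 1) (map snd bs) = bs"
    using size by (auto intro!: map_idI)
  moreover have sim: "similar_mat A (jordan_matrix bs)"
    using jnf by (simp add: jordan_nf_def)
  ultimately have sim: "similar_mat A (mat_diag (length bs) ((!) (map snd bs)))"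
    using jordan_matrix_unit_blocks[of "map snd bs"] by simp
  obtain P Q where "similar_mat_wit A (mat_diag (length bs) ((!) (map snd bs))) P Q"
    using sim unfolding similar_mat_def by blast
  from similar_mat_witD2(5)[OF A this] have "dim_row (mat_diag (length bs) ((!) (map snd bs))) = n"
    by (rule carrier_matD(1))
  then have "length bs = n"
    by (simp add: mat_diag_def)
  with sim show thesis
    using that by blast
qed

section \<open>Zeros of the ideals of a diagonalizable matrix\<close>

text \<open>
  If \<open>k\<close> diagonal entries are nonzero, the principal minor on their positions is their product.
  If there are fewer, every choice of \<open>k\<close> rows includes a zero row.
\<close>

lemma minors_diagonal_vanish_iff:
  fixes d :: "nat \<Rightarrow> 'a :: idom"
  shows "(\<forall>m \<in> minors k (mat_diag n d). m = 0) \<longleftrightarrow> card {i \<in> {0..<n}. d i \<noteq> 0} < k"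
proof
  assume vanish: "\<forall>m \<in> minors k (mat_diag n d). m = 0"
  show "card {i \<in> {0..<n}. d i \<noteq> 0} < k"
  proof (rule ccontr)
    assume "\<not> ?thesis"
    then have "k \<le> card {i \<in> {0..<n}. d i \<noteq> 0}"
      by simp
    then obtain I where I: "I \<subseteq> {i \<in> {0..<n}. d i \<noteq> 0}" "card I = k" and fin: "finite I"
      by (rule obtain_subset_with_card_n)
    have pick: "pick I i \<in> I" if "i < k" for i
      using that I pick_in_set_le by blast
    have inj: "pick I i = pick I j \<longleftrightarrow> i = j" if "i < k" "j < k" for i j
      using that I bij_betw_imp_inj_on[OF bij_betw_pick[OF fin]] by (auto simp: inj_on_def)
    have less: "pick I i < n" if "i < k" for i
      using pick[OF that] I by auto
    have "mat k k (\<lambda>(i, j). mat_diag n d $$ (pick I i, pick I j)) = mat_diag k (\<lambda>i. d (pick I i))"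
      using less inj by (intro eq_matI) (auto simp: mat_diag_def)
    then have "indexed_minor (mat_diag n d) k (pick I) (pick I) = prod_list (diag_mat (mat_diag k (\<lambda>i. d (pick I i))))"
      unfolding indexed_minor_def
      by (simp only:) (rule det_upper_triangular[of _ k], auto simp: mat_diag_def)
    also have "\<dots> = (\<Prod>i = 0..<k. d (pick I i))"
      by (simp add: prod_list_diag_prod mat_diag_def)
    also have "\<dots> \<noteq> 0"
      using pick I by fastforce
    finally have "indexed_minor (mat_diag n d) k (pick I) (pick I) \<noteq> 0" .
    moreover have "indexed_minor (mat_diag n d) k (pick I) (pick I) \<in> minors k (mat_diag n d)"
      using I unfolding minors_eq_indexed_minors by (force simp: mat_diag_def)
    ultimately show False
      using vanish by blast
  qed
next
  assume less: "card {i \<in> {0..<n}. d i \<noteq> 0} < k"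
  show "\<forall>m \<in> minors k (mat_diag n d). m = 0"
  proof
    fix m assume "m \<in> minors k (mat_diag n d)"
    then obtain I J where m: "m = indexed_minor (mat_diag n d) k (pick I) (pick J)"
      and I: "I \<subseteq> {0..<n}" "card I = k" and J: "J \<subseteq> {0..<n}" "card J = k"
      unfolding minors_eq_indexed_minors by (auto simp: mat_diag_def)
    have fin: "finite I"
      using I finite_subset by blast
    have "\<not> I \<subseteq> {i \<in> {0..<n}. d i \<noteq> 0}"
      using less I card_mono[of "{i \<in> {0..<n}. d i \<noteq> 0}" I] by auto
    then obtain i where "i \<in> I" "d i = 0"
      using I by auto
    then obtain h where h: "h < k" "d (pick I h) = 0" "pick I h < n"
      using bij_betw_imp_surj_on[OF bij_betw_pick[OF fin]] I by (metis atLeastLessThan_iff imageE subsetD)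
    have J_less: "pick J j < n" if "j < k" for j
      using that J pick_in_set_le[of j J] by auto
    have zero: "mat_diag n d $$ (pick I h, pick J j) = 0" if "j < k" for j
      using h J_less[OF that] by (auto simp: mat_diag_def)
    have "mat k k (\<lambda>(i, j). mat_diag n d $$ (pick I i, pick J j)) =
        mat\<^sub>r k k (\<lambda>i. if i = h then 0\<^sub>v k else vec k (\<lambda>j. mat_diag n d $$ (pick I i, pick J j)))"
      using h(1) zero by (intro eq_matI) auto
    then show "m = 0"
      unfolding m indexed_minor_def by (simp add: det_row_0[OF h(1)])
  qed
qed

text \<open>
  Permuting the entries of a diagonal matrix amounts to permuting its rows and columns alike, and
  then the minors merely get other row and column selections.
\<close>

lemma minors_reindex_subset:
  assumes A: "A \<in> carrier_mat n n" and p: "p \<in> {0..<n} \<rightarrow> {0..<n}"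
  shows "minors k (mat n n (\<lambda>(i, j). A $$ (p i, p j))) \<subseteq> ideal_generated (minors k A)"
proof
  fix m assume "m \<in> minors k (mat n n (\<lambda>(i, j). A $$ (p i, p j)))"
  then obtain r c where m: "m = indexed_minor (mat n n (\<lambda>(i, j). A $$ (p i, p j))) k r c"
    and rc: "r \<in> {0..<k} \<rightarrow> {0..<n}" "c \<in> {0..<k} \<rightarrow> {0..<n}"
    by (rule minor_indexedE) auto
  have "mat k k (\<lambda>(i, j). mat n n (\<lambda>(i, j). A $$ (p i, p j)) $$ (r i, c j)) =
      mat k k (\<lambda>(i, j). A $$ ((p \<circ> r) i, (p \<circ> c) j))"
    using rc by (intro eq_matI) (auto simp: Pi_iff)
  then have "m = indexed_minor A k (p \<circ> r) (p \<circ> c)"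
    unfolding m indexed_minor_def by simp
  also have "\<dots> \<in> ideal_generated (minors k A)"
    using A p rc by (intro indexed_minor_in_ideal) auto
  finally show "m \<in> ideal_generated (minors k A)" .
qed

lemma ideal_minors_permuted_diagonal_subset:
  assumes p: "p permutes {0..<n}" and d: "\<And>i. i < n \<Longrightarrow> d i = d' (p i)"
  shows "ideal_generated (minors k (char_poly_matrix (mat_diag n d))) \<subseteq>
    ideal_generated (minors k (char_poly_matrix (mat_diag n d')))"
proof -
  have pn: "p i < n" if "i < n" for i
    using permutes_in_image[OF p, of i] that by simp
  have pinj: "p i = p j \<longleftrightarrow> i = j" for i j
    using permutes_inj[OF p] by (auto dest: injD)
  have "char_poly_matrix (mat_diag n d) =
      mat n n (\<lambda>(i, j). char_poly_matrix (mat_diag n d') $$ (p i, p j))"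
    using pn d pinj by (intro eq_matI) (auto simp: char_poly_matrix_def mat_diag_def)
  then show ?thesis
    using ideal_generated_least[OF minors_reindex_subset[of "char_poly_matrix (mat_diag n d')" n p k]] pn
    by simp
qed

lemma poly_zero_set_ideal_minors:
  fixes A :: "'a :: idom mat"
  assumes sim: "similar_mat A (mat_diag n d)"
  shows "(\<forall>p \<in> ideal_generated (minors k (char_poly_matrix A)). poly p a = 0) \<longleftrightarrow>
    card {i \<in> {0..<n}. d i \<noteq> a} < k"
proof -
  have hom: "comm_ring_hom (\<lambda>p. poly p a)"
    by unfold_locales auto
  have "map_mat (\<lambda>p. poly p a) (char_poly_matrix (mat_diag n d)) = mat_diag n (\<lambda>i. a - d i)"
    by (intro eq_matI) (auto simp: char_poly_matrix_def mat_diag_def)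
  moreover have "{i \<in> {0..<n}. a - d i \<noteq> 0} = {i \<in> {0..<n}. d i \<noteq> a}"
    by auto
  ultimately show ?thesis
    unfolding ideal_minors_char_poly_matrix_similar[OF sim] ideal_minors_vanish_iff[OF hom]
    by (simp add: minors_diagonal_vanish_iff)
qed

text \<open>
  The zero sets give the number of \<open>i\<close> with \<open>d i \<noteq> a\<close> for every \<open>a\<close>, hence the multiset of
  diagonal entries. The range \<open>{1..n}\<close> is enough because these numbers lie between \<open>0\<close> and \<open>n\<close>.
\<close>

lemma diagonalizable_ideal_minors_eqI:
  fixes A B :: "'a :: idom mat"
  assumes simA: "similar_mat A (mat_diag n d)" and simB: "similar_mat B (mat_diag n d')"
    and zeros: "\<And>k a. k \<in> {1..n} \<Longrightarrow>
      (\<forall>p \<in> ideal_generated (minors k (char_poly_matrix A)). poly p a = 0) \<longleftrightarrow>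
      (\<forall>p \<in> ideal_generated (minors k (char_poly_matrix B)). poly p a = 0)"
  shows "ideal_generated (minors k (char_poly_matrix A)) =
    ideal_generated (minors k (char_poly_matrix B))"
proof -
  have "card {i \<in> {0..<n}. d i = a} = card {i \<in> {0..<n}. d' i = a}" for a
  proof -
    have compl: "card {i \<in> {0..<n}. g i = a} + card {i \<in> {0..<n}. g i \<noteq> a} = n" for g
    proof -
      have "card {i \<in> {0..<n}. g i = a} + card {i \<in> {0..<n}. g i \<noteq> a} =
          card ({i \<in> {0..<n}. g i = a} \<union> {i \<in> {0..<n}. g i \<noteq> a})"
        by (rule card_Un_disjoint[symmetric]) auto
      also have "{i \<in> {0..<n}. g i = a} \<union> {i \<in> {0..<n}. g i \<noteq> a} = {0..<n}"
        by auto
      finally show ?thesis by simp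
    qed
    have "card {i \<in> {0..<n}. d i \<noteq> a} < k \<longleftrightarrow> card {i \<in> {0..<n}. d' i \<noteq> a} < k" if "k \<in> {1..n}" for k
      using zeros[OF that, of a]
      unfolding poly_zero_set_ideal_minors[OF simA] poly_zero_set_ideal_minors[OF simB] .
    \<comment> \<open>Were the two numbers different, the larger one, taken as \<open>k\<close>, would separate them; it is positive.\<close>
    from this[of "card {i \<in> {0..<n}. d i \<noteq> a}"] this[of "card {i \<in> {0..<n}. d' i \<noteq> a}"]
    show ?thesis
      using compl[of d] compl[of d'] by (simp add: Suc_le_eq) linarith
  qed
  then have "image_mset d (mset_set {0..<n}) = image_mset d' (mset_set {0..<n})"
    by (intro multiset_eqI) (simp add: count_image_mset_eq_card_vimage)
  then obtain p where p: "p permutes {0..<n}" "\<forall>i \<in> {0..<n}. d i = d' (p i)"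
    by (rule image_mset_eq_implies_permutes[rotated]) auto
  have "d' i = d (Hilbert_Choice.inv p i)" if "i < n" for i
    using p permutes_in_image[OF permutes_inv[OF p(1)], of i] that by (simp add: permutes_inverses)
  with p have "ideal_generated (minors k (char_poly_matrix (mat_diag n d))) =
      ideal_generated (minors k (char_poly_matrix (mat_diag n d')))"
    by (intro subset_antisym ideal_minors_permuted_diagonal_subset[of p]
        ideal_minors_permuted_diagonal_subset[OF permutes_inv[OF p(1)]]) auto
  then show ?thesis
    using ideal_minors_char_poly_matrix_similar[OF simA]
      ideal_minors_char_poly_matrix_similar[OF simB] by simp
qed

section \<open>Matrices of graphs\<close>

lemma (in sym_digraph) awalk_reverse:
  "awalk u p v \<Longrightarrow> \<exists>q. awalk v q u \<and> length q = length p"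
proof (induction p arbitrary: u)
  case Nil
  then show ?case
    by (auto intro: exI[of _ "[]"] simp: awalk_Nil_iff)
next
  case (Cons e p)
  then have e: "e \<in> arcs G" "u = tail G e" and p: "awalk (head G e) p v"
    by (auto simp: awalk_Cons_iff)
  obtain q where q: "awalk v q (head G e)" "length q = length p"
    using Cons.IH[OF p] by blast
  have "(head G e, u) \<in> arcs_ends G"
    using sym_arcs in_arcs_imp_in_arcs_ends[OF e(1)] e(2) unfolding symmetric_def by (auto dest: symD)
  then obtain e' where e': "e' \<in> arcs G" "tail G e' = head G e" "head G e' = u"
    by (auto simp: arcs_ends_conv)
  have "awalk v (q @ [e']) u"
    using q(1) arc_implies_awalk[OF e'(1)] e' by (intro awalk_appendI) auto
  with q(2) show ?case
    by (intro exI[of _ "q @ [e']"]) simp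
qed

lemma (in sym_digraph) graph_dist_commute: "graph_dist G u v = graph_dist G v u"
proof -
  have "(\<exists>p. awalk u p v \<and> length p = k) \<longleftrightarrow> (\<exists>p. awalk v p u \<and> length p = k)" for k
    using awalk_reverse by metis
  then show ?thesis
    unfolding graph_dist_def by simp
qed

lemma graph_mat_carrier: "graph_mat M G n e \<in> carrier_mat n n"
  by (cases M) (auto simp: adjacency_mat_def distance_mat_def)

lemma transpose_graph_mat:
  assumes "graph G"
  shows "(graph_mat M G n e)\<^sup>T = graph_mat M G n e"
proof -
  interpret graph G by fact
  have "(u, v) \<in> arcs_ends G \<longleftrightarrow> (v, u) \<in> arcs_ends G" for u v
    using sym_arcs unfolding symmetric_def by (auto dest: symD)
  then have adj: "(adjacency_mat G n e)\<^sup>T = adjacency_mat G n e"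
    unfolding adjacency_mat_def by (intro eq_matI) auto
  have dist: "(distance_mat G n e)\<^sup>T = distance_mat G n e"
    unfolding distance_mat_def by (intro eq_matI) (auto simp: graph_dist_commute)
  have minus: "(mat_diag n g - A)\<^sup>T = mat_diag n g - A"
    if "A \<in> carrier_mat n n" "A\<^sup>T = A" for g :: "nat \<Rightarrow> 'r :: comm_ring_1" and A
  proof -
    have "A $$ (i, j) = A $$ (j, i)" if "i < n" "j < n" for i j
      using that \<open>A \<in> carrier_mat n n\<close> index_transpose_mat(1)[of i A j] \<open>A\<^sup>T = A\<close> by simp
    then show ?thesis
      using that(1) by (intro eq_matI) (auto simp: mat_diag_def)
  qed
  have "adjacency_mat G n e \<in> carrier_mat n n" "distance_mat G n e \<in> carrier_mat n n"
    by (auto simp: adjacency_mat_def distance_mat_def)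
  then show ?thesis
    using adj dist minus by (cases M) auto
qed

lemma graph_mat_of_int: "map_mat of_int (graph_mat M G n e) = graph_mat M G n e"
  by (cases M; intro eq_matI) (auto simp: adjacency_mat_def distance_mat_def mat_diag_def)

text \<open>
  Both ideals have the same generators, up to the embedding of integer into real polynomials. The
  ideal on the left consists of integer polynomials, the one on the right of real ones.
\<close>

lemma real_variety_determinantal_ideal:
  "real_variety (determinantal_ideal k M G n e) =
    {a. \<forall>p \<in> determinantal_ideal k M G n e. poly p a = 0}"
proof -
  have "(\<forall>f \<in> determinantal_ideal k M G n e. poly (map_poly of_int f) a = 0) \<longleftrightarrow>
      (\<forall>p \<in> determinantal_ideal k M G n e. poly p a = 0)" for a :: real
  proof -
    let ?A = "char_poly_matrix (graph_mat M G n e) :: int poly mat"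
    have eval: "comm_ring_hom (\<lambda>p. poly p a)"
      by unfold_locales auto
    have int_eval: "comm_ring_hom (\<lambda>f. poly (map_poly of_int f) a)"
      by unfold_locales (auto simp: hom_distribs)
    have "map_mat (\<lambda>f. poly (map_poly of_int f) a) ?A =
        map_mat (\<lambda>p. poly p a) (map_mat (map_poly of_int) ?A)"
      by (intro eq_matI) auto
    also have "map_mat (map_poly of_int) ?A = char_poly_matrix (graph_mat M G n e)"
      by (simp add: graph_mat_of_int flip: of_int_hom.char_poly_matrix_hom[OF graph_mat_carrier])
    finally show ?thesis
      unfolding determinantal_ideal_def ideal_minors_vanish_iff[OF eval] ideal_minors_vanish_iff[OF int_eval]
      by simp
  qed
  then show ?thesis
    unfolding real_variety_def by simp
qed

theorem theorem30:
  fixes G :: "('a, 'b) pre_digraph" and H :: "('c, 'd) pre_digraph"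
    and M :: matrix_kind and n :: nat
    and e :: "nat \<Rightarrow> 'a" and f :: "nat \<Rightarrow> 'c"
  assumes "graph G" and "connected G" and "vertex_enum G n e"
    and "graph H" and "connected H" and "vertex_enum H n f"
  shows "codeterminantal TYPE(real) M n G e H f \<longleftrightarrow>
    (\<forall>k \<in> {1..n}. real_variety (determinantal_ideal k M G n e) =
                  real_variety (determinantal_ideal k M H n f))"
proof
  assume "codeterminantal TYPE(real) M n G e H f"
  then show "\<forall>k \<in> {1..n}. real_variety (determinantal_ideal k M G n e) =
      real_variety (determinantal_ideal k M H n f)"
    unfolding codeterminantal_def real_variety_determinantal_ideal by simp
next
  assume var: "\<forall>k \<in> {1..n}. real_variety (determinantal_ideal k M G n e) =
      real_variety (determinantal_ideal k M H n f)"
  let ?A = "graph_mat M G n e :: real mat" and ?B = "graph_mat M H n f :: real mat"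
  obtain d where d: "similar_mat ?A (mat_diag n d)"
    using symmetric_similar_diagonal[OF graph_mat_carrier transpose_graph_mat[OF \<open>graph G\<close>]] .
  obtain d' where d': "similar_mat ?B (mat_diag n d')"
    using symmetric_similar_diagonal[OF graph_mat_carrier transpose_graph_mat[OF \<open>graph H\<close>]] .
  have zeros: "(\<forall>p \<in> ideal_generated (minors k (char_poly_matrix ?A)). poly p a = 0) \<longleftrightarrow>
      (\<forall>p \<in> ideal_generated (minors k (char_poly_matrix ?B)). poly p a = 0)"
    if "k \<in> {1..n}" for k a
    using bspec[OF var that] unfolding real_variety_determinantal_ideal
    unfolding determinantal_ideal_def by (simp add: set_eq_iff)
  show "codeterminantal TYPE(real) M n G e H f"
    unfolding codeterminantal_def determinantal_ideal_def
    using diagonalizable_ideal_minors_eqI[OF d d' zeros] by blast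
qed

end
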